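(* Let $\alpha$ be an ordinal and let $\Gamma$ be a sequent of $\mu\mathsf{MALL}_{\alpha,\alpha}$. Then $\Gamma$ is provable in the cut-free system $\mu\mathsf{MALL}_{\alpha,\alpha}^{\mathit{cf}}$ if and only if the focussed sequent $\cdot \Uparrow \Gamma$ is provable in the focussed system $\mu\mathsf{MALL}\mathsf{F}_{\alpha,\alpha}^{\mathit{cf}}$.
   Context: Syntax. Fix disjoint sets $\mathsf{Var}$ (variables $x,y,\dots$) and $\mathsf{Prop}$ (propositional symbols $p,q,\dots$) and an ordinal $\alpha$. Formulas of $\mu\mathsf{MALL}_{\alpha,\alpha}$ are generated by $x \mid p \mid p^\perp \mid 1 \mid \bot \mid 0 \mid \top \mid A\otimes B \mid A \wp B \mid A\oplus B \mid A \mathbin{\&} B \mid \mu^\beta x A \mid \nu^\beta x A$ with $\beta\le\alpha$ ($\wp$ denotes multiplicative disjunction, "par"); $\mu^\beta x$, $\nu^\beta x$ bind $x$. Negation $A^\perp$ is defined by $x^\perp=x$, $(p^\perp)^\perp=p$, and the De Morgan dualities $1/\bot$, $0/\top$, $\otimes/\wp$, $\oplus/\&$, $\mu^\beta x/\nu^\beta x$. A literal is $p$ or $p^\perp$ with $p\in\mathsf{Prop}$. A sequent is a finite multiset of formulas; $A(B)$ denotes capture-avoiding substitution of $B$ for $x$ in $A(x)$. System $\mu\mathsf{MALL}_{\alpha,\alpha}^{\mathit{cf}}$. Rules (premises / conclusion): ($\mathsf{id}$) no premise / $A,A^\perp$; ($1$) no premise / $1$; ($\bot$) $\Gamma$ /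 $\Gamma,\bot$; ($\top$) no premise / $\Gamma,\top$; no rule for $0$; ($\otimes$) $\Gamma,A$ and $\Delta,B$ / $\Gamma,\Delta,A\otimes B$; ($\wp$) $\Gamma,A,B$ / $\Gamma,A\wp B$; ($\oplus$) $\Gamma,A_i$ / $\Gamma,A_0\oplus A_1$ ($i\in\{0,1\}$); ($\&$) $\Gamma,A$ and $\Gamma,B$ / $\Gamma,A\mathbin{\&}B$; and for each $\beta\le\alpha$: ($\mu^\beta$) $\Gamma,A(\mu^\gamma x A(x))$ / $\Gamma,\mu^\beta x A(x)$ for any one $\gamma<\beta$; ($\nu^\beta$) the family $\{\Gamma,A(\nu^\gamma x A(x))\}_{\gamma<\beta}$ / $\Gamma,\nu^\beta x A(x)$. Proofs (here and below) are well-founded, possibly infinitely branching, trees. Polarity. Positive formulas: $p$, $0$, $1$, $A\oplus B$, $A\otimes B$, $\mu^\beta x A$. Negative formulas: $p^\perp$, $\bot$, $\top$, $A\wp B$, $A\mathbin{\&}B$, $\nu^\beta x A$. Focussed system $\mu\mathsf{MALL}\mathsf{F}_{\alpha,\alpha}^{\mathit{cf}}$. Sequents are $\Gamma\Downarrow A$ or $\Gamma\Uparrow\Theta$, with $\Gamma$ a finite multiset of formulas, $A$ a formula, $\Theta$ a finite list of formulas ($\cdot$ denotes empty; in $\cdot\Uparrow\Gamma$ the formulas of $\Gamma$ are written as a list). Rules (premises / conclusion): Identity and focussing: ($\mathsf{id}$) no premise / $p\Downarrow p^\perp$ for $p\in\mathsf{Prop}$; (store) $\Gamma,A\Uparrow\Delta$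 / $\Gamma\Uparrow\Delta,A$ for $A$ positive or a literal; (decide) $\Gamma\Downarrow A$ / $\Gamma,A\Uparrow\cdot$ for $A$ positive; (release) $\Gamma\Uparrow A$ / $\Gamma\Downarrow A$ for $A$ negative or a literal. Asynchronous: ($\top$) no premise / $\Gamma\Uparrow\Delta,\top$; ($\bot$) $\Gamma\Uparrow\Delta$ / $\Gamma\Uparrow\Delta,\bot$; ($\wp$) $\Gamma\Uparrow\Delta,A,B$ / $\Gamma\Uparrow\Delta,A\wp B$; ($\&$) $\Gamma\Uparrow\Delta,A$ and $\Gamma\Uparrow\Delta,B$ / $\Gamma\Uparrow\Delta,A\mathbin{\&}B$; ($\nu^\beta$) $\{\Gamma\Uparrow\Delta,A(\nu^\gamma xA(x))\}_{\gamma<\beta}$ / $\Gamma\Uparrow\Delta,\nu^\beta xA(x)$. Synchronous: ($1$) no premise / $\cdot\Downarrow1$; ($\oplus$) $\Gamma\Downarrow A_i$ / $\Gamma\Downarrow A_0\oplus A_1$ ($i\in\{0,1\}$); ($\otimes$) $\Gamma\Downarrow A$ and $\Delta\Downarrow B$ / $\Gamma,\Delta\Downarrow A\otimes B$; ($\mu^\beta$) $\Gamma\Downarrow A(\mu^\gamma xA(x))$ / $\Gamma\Downarrow\mu^\beta xA(x)$ for any one $\gamma<\beta$.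
   Formalization: The focussed identity rule is taken for both literals, adding p^⊥ ⇓ p to p ⇓ p^⊥ (otherwise p, p^⊥ has no focussed proof), and sequents consist of closed formulas (otherwise x, x is provable by id but has no focussed proof). *)

theory Defs
  imports "HOL-Library.Multiset"
begin

text \<open>
  Formulas are taken modulo renaming of bound variables: \<open>Var n\<close> is a de Bruijn index, and
  \<open>Mu\<close> and \<open>Nu\<close> bind index 0 of their body. Ordinals are elements of a type
  \<open>'o\<close> of class \<open>wellorder\<close>. Only the ordinals up to a fixed
  \<open>\<alpha>\<close> occur, and only their order matters. The elements below \<open>\<alpha>\<close> can have any
  order type, as \<open>'o\<close> is arbitrary.
\<close>

datatype (propositions: 'p, ordinals: 'o) formula =
    Var nat
  | Prop 'p
  | NProp 'p
  | One
  | Bot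
  | Zero
  | Top
  | Tensor "('p, 'o) formula" "('p, 'o) formula"
  | Par "('p, 'o) formula" "('p, 'o) formula"
  | Plus "('p, 'o) formula" "('p, 'o) formula"
  | With "('p, 'o) formula" "('p, 'o) formula"
  | Mu 'o "('p, 'o) formula"
  | Nu 'o "('p, 'o) formula"

primrec neg :: "('p, 'o) formula \<Rightarrow> ('p, 'o) formula" where
  "neg (Var n) = Var n"
| "neg (Prop p) = NProp p"
| "neg (NProp p) = Prop p"
| "neg One = Bot"
| "neg Bot = One"
| "neg Zero = Top"
| "neg Top = Zero"
| "neg (Tensor A B) = Par (neg A) (neg B)"
| "neg (Par A B) = Tensor (neg A) (neg B)"
| "neg (Plus A B) = With (neg A) (neg B)"
| "neg (With A B) = Plus (neg A) (neg B)"
| "neg (Mu \<beta> A) = Nu \<beta> (neg A)"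
| "neg (Nu \<beta> A) = Mu \<beta> (neg A)"

primrec lift :: "nat \<Rightarrow> ('p, 'o) formula \<Rightarrow> ('p, 'o) formula" where
  "lift k (Var n) = Var (if n < k then n else Suc n)"
| "lift k (Prop p) = Prop p"
| "lift k (NProp p) = NProp p"
| "lift k One = One"
| "lift k Bot = Bot"
| "lift k Zero = Zero"
| "lift k Top = Top"
| "lift k (Tensor A B) = Tensor (lift k A) (lift k B)"
| "lift k (Par A B) = Par (lift k A) (lift k B)"
| "lift k (Plus A B) = Plus (lift k A) (lift k B)"
| "lift k (With A B) = With (lift k A) (lift k B)"
| "lift k (Mu \<beta> A) = Mu \<beta> (lift (Suc k) A)"
| "lift k (Nu \<beta> A) = Nu \<beta> (lift (Suc k) A)"

text \<open>
  \<open>subst A k B\<close> replaces index \<open>k\<close> in \<open>A\<close> by \<open>B\<close> without capture and removes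
  the binder of \<open>k\<close>. So \<open>subst A 0 B\<close> is \<open>A(B)\<close> when \<open>A\<close> is the
  body of a fixed point.
\<close>

primrec subst :: "('p, 'o) formula \<Rightarrow> nat \<Rightarrow> ('p, 'o) formula \<Rightarrow> ('p, 'o) formula" where
  "subst (Var n) k C = (if n < k then Var n else if n = k then C else Var (n - 1))"
| "subst (Prop p) k C = Prop p"
| "subst (NProp p) k C = NProp p"
| "subst One k C = One"
| "subst Bot k C = Bot"
| "subst Zero k C = Zero"
| "subst Top k C = Top"
| "subst (Tensor A B) k C = Tensor (subst A k C) (subst B k C)"
| "subst (Par A B) k C = Par (subst A k C) (subst B k C)"
| "subst (Plus A B) k C = Plus (subst A k C) (subst B k C)"
| "subst (With A B) k C = With (subst A k C) (subst B k C)"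
| "subst (Mu \<beta> A) k C = Mu \<beta> (subst A (Suc k) (lift 0 C))"
| "subst (Nu \<beta> A) k C = Nu \<beta> (subst A (Suc k) (lift 0 C))"

text \<open>All free indices are below \<open>k\<close>.\<close>

primrec closed_below :: "nat \<Rightarrow> ('p, 'o) formula \<Rightarrow> bool" where
  "closed_below k (Var n) \<longleftrightarrow> n < k"
| "closed_below k (Prop p) \<longleftrightarrow> True"
| "closed_below k (NProp p) \<longleftrightarrow> True"
| "closed_below k One \<longleftrightarrow> True"
| "closed_below k Bot \<longleftrightarrow> True"
| "closed_below k Zero \<longleftrightarrow> True"
| "closed_below k Top \<longleftrightarrow> True"
| "closed_below k (Tensor A B) \<longleftrightarrow> closed_below k A \<and> closed_below k B"
| "closed_below k (Par A B) \<longleftrightarrow> closed_below k A \<and> closed_below k B"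
| "closed_below k (Plus A B) \<longleftrightarrow> closed_below k A \<and> closed_below k B"
| "closed_below k (With A B) \<longleftrightarrow> closed_below k A \<and> closed_below k B"
| "closed_below k (Mu \<beta> A) \<longleftrightarrow> closed_below (Suc k) A"
| "closed_below k (Nu \<beta> A) \<longleftrightarrow> closed_below (Suc k) A"

text \<open>
  Formulas in sequents are closed. A free variable \<open>x\<close> has no polarity, while
  \<open>x\<close> is its own negation, so the unfocussed identity rule would prove \<open>x, x\<close>,
  on which no focussed rule acts.
\<close>

definition sequent :: "'o::wellorder \<Rightarrow> ('p, 'o) formula multiset \<Rightarrow> bool" where
  "sequent \<alpha> \<Gamma> \<longleftrightarrow> (\<forall>A \<in># \<Gamma>. closed_below 0 A \<and> (\<forall>\<beta> \<in> ordinals A. \<beta> \<le> \<alpha>))"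

text \<open>
  Provability is an inductive predicate, so its derivations are exactly the well-founded,
  possibly infinitely branching, proof trees. Read from conclusion to premises, the rules
  stay within the sequents of \<open>sequent \<alpha>\<close>, so it suffices to impose that condition on
  the end-sequent.
\<close>

inductive provable_cf :: "'o::wellorder \<Rightarrow> ('p, 'o) formula multiset \<Rightarrow> bool" for \<alpha> where
  cf_id: "provable_cf \<alpha> {#A, neg A#}"
| cf_one: "provable_cf \<alpha> {#One#}"
| cf_bot: "provable_cf \<alpha> \<Gamma> \<Longrightarrow> provable_cf \<alpha> (\<Gamma> + {#Bot#})"
| cf_top: "provable_cf \<alpha> (\<Gamma> + {#Top#})"
| cf_tensor: "provable_cf \<alpha> (\<Gamma> + {#A#}) \<Longrightarrow> provable_cf \<alpha> (\<Delta> + {#B#}) \<Longrightarrow>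
    provable_cf \<alpha> (\<Gamma> + \<Delta> + {#Tensor A B#})"
| cf_par: "provable_cf \<alpha> (\<Gamma> + {#A, B#}) \<Longrightarrow> provable_cf \<alpha> (\<Gamma> + {#Par A B#})"
| cf_plus0: "provable_cf \<alpha> (\<Gamma> + {#A#}) \<Longrightarrow> provable_cf \<alpha> (\<Gamma> + {#Plus A B#})"
| cf_plus1: "provable_cf \<alpha> (\<Gamma> + {#B#}) \<Longrightarrow> provable_cf \<alpha> (\<Gamma> + {#Plus A B#})"
| cf_with: "provable_cf \<alpha> (\<Gamma> + {#A#}) \<Longrightarrow> provable_cf \<alpha> (\<Gamma> + {#B#}) \<Longrightarrow>
    provable_cf \<alpha> (\<Gamma> + {#With A B#})"
| cf_mu: "\<beta> \<le> \<alpha> \<Longrightarrow> \<gamma> < \<beta> \<Longrightarrow> provable_cf \<alpha> (\<Gamma> + {#subst A 0 (Mu \<gamma> A)#}) \<Longrightarrow>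
    provable_cf \<alpha> (\<Gamma> + {#Mu \<beta> A#})"
| cf_nu: "\<beta> \<le> \<alpha> \<Longrightarrow> (\<And>\<gamma>. \<gamma> < \<beta> \<Longrightarrow> provable_cf \<alpha> (\<Gamma> + {#subst A 0 (Nu \<gamma> A)#})) \<Longrightarrow>
    provable_cf \<alpha> (\<Gamma> + {#Nu \<beta> A#})"

fun positive :: "('p, 'o) formula \<Rightarrow> bool" where
  "positive (Prop p) = True"
| "positive Zero = True"
| "positive One = True"
| "positive (Plus A B) = True"
| "positive (Tensor A B) = True"
| "positive (Mu \<beta> A) = True"
| "positive _ = False"

fun negative :: "('p, 'o) formula \<Rightarrow> bool" where
  "negative (NProp p) = True"
| "negative Bot = True"
| "negative Top = True"
| "negative (Par A B) = True"
| "negative (With A B) = True"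
| "negative (Nu \<beta> A) = True"
| "negative _ = False"

fun literal :: "('p, 'o) formula \<Rightarrow> bool" where
  "literal (Prop p) = True"
| "literal (NProp p) = True"
| "literal _ = False"

datatype ('p, 'o) focussed_sequent =
    Focus "('p, 'o) formula multiset" "('p, 'o) formula" (infix \<open>\<Down>\<close> 55)
  | Unfocus "('p, 'o) formula multiset" "('p, 'o) formula list" (infix \<open>\<Up>\<close> 55)

text \<open>
  The identity rule is \<open>A \<Down> A\<^sup>\<bottom>\<close> for every literal \<open>A\<close>, that is, both
  \<open>p \<Down> p\<^sup>\<bottom>\<close> and \<open>p\<^sup>\<bottom> \<Down> p\<close>. The first alone is not enough: \<open>p\<close> is
  positive and \<open>decide\<close> selects only positive formulas, so a proof search for
  \<open>p, p\<^sup>\<bottom>\<close> can only reach \<open>p\<^sup>\<bottom> \<Down> p\<close> and, by \<open>release\<close> and \<open>store\<close>, return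
  to its starting point.
\<close>

inductive provable_foc :: "'o::wellorder \<Rightarrow> ('p, 'o) focussed_sequent \<Rightarrow> bool" for \<alpha> where
  foc_id: "literal A \<Longrightarrow> provable_foc \<alpha> ({#A#} \<Down> neg A)"
| foc_store: "positive A \<or> literal A \<Longrightarrow> provable_foc \<alpha> (\<Gamma> + {#A#} \<Up> \<Delta>) \<Longrightarrow>
    provable_foc \<alpha> (\<Gamma> \<Up> \<Delta> @ [A])"
| foc_decide: "positive A \<Longrightarrow> provable_foc \<alpha> (\<Gamma> \<Down> A) \<Longrightarrow> provable_foc \<alpha> (\<Gamma> + {#A#} \<Up> [])"
| foc_release: "negative A \<or> literal A \<Longrightarrow> provable_foc \<alpha> (\<Gamma> \<Up> [A]) \<Longrightarrow> provable_foc \<alpha> (\<Gamma> \<Down> A)"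
| foc_top: "provable_foc \<alpha> (\<Gamma> \<Up> \<Delta> @ [Top])"
| foc_bot: "provable_foc \<alpha> (\<Gamma> \<Up> \<Delta>) \<Longrightarrow> provable_foc \<alpha> (\<Gamma> \<Up> \<Delta> @ [Bot])"
| foc_par: "provable_foc \<alpha> (\<Gamma> \<Up> \<Delta> @ [A, B]) \<Longrightarrow> provable_foc \<alpha> (\<Gamma> \<Up> \<Delta> @ [Par A B])"
| foc_with: "provable_foc \<alpha> (\<Gamma> \<Up> \<Delta> @ [A]) \<Longrightarrow> provable_foc \<alpha> (\<Gamma> \<Up> \<Delta> @ [B]) \<Longrightarrow>
    provable_foc \<alpha> (\<Gamma> \<Up> \<Delta> @ [With A B])"
| foc_nu: "\<beta> \<le> \<alpha> \<Longrightarrow> (\<And>\<gamma>. \<gamma> < \<beta> \<Longrightarrow> provable_foc \<alpha> (\<Gamma> \<Up> \<Delta> @ [subst A 0 (Nu \<gamma> A)])) \<Longrightarrow>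
    provable_foc \<alpha> (\<Gamma> \<Up> \<Delta> @ [Nu \<beta> A])"
| foc_one: "provable_foc \<alpha> ({#} \<Down> One)"
| foc_plus0: "provable_foc \<alpha> (\<Gamma> \<Down> A) \<Longrightarrow> provable_foc \<alpha> (\<Gamma> \<Down> Plus A B)"
| foc_plus1: "provable_foc \<alpha> (\<Gamma> \<Down> B) \<Longrightarrow> provable_foc \<alpha> (\<Gamma> \<Down> Plus A B)"
| foc_tensor: "provable_foc \<alpha> (\<Gamma> \<Down> A) \<Longrightarrow> provable_foc \<alpha> (\<Delta> \<Down> B) \<Longrightarrow>
    provable_foc \<alpha> (\<Gamma> + \<Delta> \<Down> Tensor A B)"
| foc_mu: "\<beta> \<le> \<alpha> \<Longrightarrow> \<gamma> < \<beta> \<Longrightarrow> provable_foc \<alpha> (\<Gamma> \<Down> subst A 0 (Mu \<gamma> A)) \<Longrightarrow>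
    provable_foc \<alpha> (\<Gamma> \<Down> Mu \<beta> A)"

end

theory Submission
  imports Defs
begin

text \<open>
  Forgetting the focus turns every focussed rule into an unfocussed one, or into no step at all, so
  focussed provability implies unfocussed provability (\<open>provable_foc_sound\<close>).

  For the converse, consider the possible results of running an asynchronous phase on a formula
  until only storable formulas are left: an additive conjunction contributes the results of its
  two components as alternatives, a par combines a result of the left component with one of the right
  component, \<open>Top\<close> has no result at all. These multisets are the \<^emph>\<open>outcomes\<close> of the formula, and
  the outcomes of a sequent are the sums of outcomes of its members. Call a sequent good
  (\<open>foc_outcomes\<close>) if each of its outcomes \<open>M\<close> makes \<open>M \<Up> []\<close> provable. Goodness is a
  property of multisets: it does not see the order in which the formulas are processed. Two facts
  make it the right notion.

  \<^item> If \<open>mset \<Theta>\<close> is good then \<open>{#} \<Up> \<Theta>\<close> is provable (\<open>provable_foc_of_outcomes\<close>), because asynchronous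
    phases on well-formed formulas terminate. Termination is not evident, as \<open>Nu \<beta> A\<close> may unfold to a
    larger formula; it is contained in an induction principle for well-formed formulas
    (\<open>wff_induct\<close>) whose step for a fixed point goes from all of its unfoldings to the fixed point.

  \<^item> Goodness is closed under all rules of the unfocussed system. For asynchronous rules this is
    immediate from the definition of outcomes. A synchronous rule with premise \<open>\<Gamma>, A\<close> must be applied
    late, at the points of the given proof where \<open>A\<close> comes under focus. The lemma \<open>foc_replace\<close> does
    this: it replaces \<open>A\<close> by other stored formulas throughout a proof, given a way to treat the
    sequents with \<open>A\<close> in focus. It resembles a cut with a formula that is principal on one side, and is proved by
    induction on the proof in which \<open>A\<close> is stored. Identities follow from the other rules by \<open>wff_induct\<close>, which expands them down to literals.
\<close>

section \<open>Well-formed formulas and induction along unfoldings\<close>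

lemma neg_neg [simp]: "neg (neg A) = A"
  by (induction A) auto

lemma neg_lift: "neg (lift k A) = lift k (neg A)"
  by (induction A arbitrary: k) auto

lemma neg_subst: "neg (subst A k C) = subst (neg A) k (neg C)"
  by (induction A arbitrary: k C) (auto simp: neg_lift)

lemma lift_closed: "closed_below j A \<Longrightarrow> j \<le> k \<Longrightarrow> lift k A = A"
  by (induction A arbitrary: j k) fastforce+

lemma closed_below_mono: "closed_below j A \<Longrightarrow> j \<le> k \<Longrightarrow> closed_below k A"
  by (induction A arbitrary: j k) fastforce+

lemma closed_below_subst:
  "closed_below (Suc n) A \<Longrightarrow> k \<le> n \<Longrightarrow> closed_below 0 C \<Longrightarrow> closed_below n (subst A k C)"
  by (induction A arbitrary: n k) (auto simp: lift_closed intro: closed_below_mono)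

lemma ordinals_lift: "ordinals (lift k A) = ordinals A"
  by (induction A arbitrary: k) auto

lemma ordinals_subst: "ordinals (subst A k C) \<subseteq> ordinals A \<union> ordinals C"
  by (induction A arbitrary: k C) (auto simp: ordinals_lift, (fastforce simp: ordinals_lift)+)

lemma subst_closed: "closed_below j C \<Longrightarrow> j \<le> k \<Longrightarrow> subst C k D = C"
  by (induction C arbitrary: j k D) fastforce+

lemma subst_subst:
  assumes "closed_below 0 C" "closed_below 0 D"
  shows "j \<le> k \<Longrightarrow> subst (subst A (Suc k) C) j D = subst (subst A j D) k C"
proof (induction A arbitrary: j k)
  case (Var n)
  then show ?case
    using subst_closed[OF assms(1), of j D] subst_closed[OF assms(2), of k C] by auto
qed (auto simp: lift_closed[OF assms(1)] lift_closed[OF assms(2)])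

text \<open>
  The formulas in the list replace the indices \<open>k, k + 1, \<dots>\<close>, in this order, since each
  substitution lowers the remaining indices by one.
\<close>

fun substs :: "nat \<Rightarrow> ('p, 'o) formula list \<Rightarrow> ('p, 'o) formula \<Rightarrow> ('p, 'o) formula" where
  "substs k [] A = A"
| "substs k (C # Cs) A = substs k Cs (subst A k C)"

definition wff :: "'o::wellorder \<Rightarrow> ('p, 'o) formula \<Rightarrow> bool" where
  "wff \<alpha> A \<longleftrightarrow> closed_below 0 A \<and> (\<forall>\<beta> \<in> ordinals A. \<beta> \<le> \<alpha>)"


lemma wff_simps [simp]:
  "wff \<alpha> (Tensor A B) \<longleftrightarrow> wff \<alpha> A \<and> wff \<alpha> B"
  "wff \<alpha> (Par A B) \<longleftrightarrow> wff \<alpha> A \<and> wff \<alpha> B"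
  "wff \<alpha> (Plus A B) \<longleftrightarrow> wff \<alpha> A \<and> wff \<alpha> B"
  "wff \<alpha> (With A B) \<longleftrightarrow> wff \<alpha> A \<and> wff \<alpha> B"
  by (auto simp: wff_def)

lemma wff_unfold:
  assumes "\<gamma> < \<beta>"
  shows "wff \<alpha> (Mu \<beta> A) \<Longrightarrow> wff \<alpha> (subst A 0 (Mu \<gamma> A))"
    and "wff \<alpha> (Nu \<beta> A) \<Longrightarrow> wff \<alpha> (subst A 0 (Nu \<gamma> A))"
  using assms ordinals_subst[of A 0 "Mu \<gamma> A"] ordinals_subst[of A 0 "Nu \<gamma> A"]
  unfolding wff_def by (force intro!: closed_below_subst)+

lemma sequent_wff: "sequent \<alpha> \<Gamma> \<longleftrightarrow> (\<forall>A \<in># \<Gamma>. wff \<alpha> A)"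
  by (simp add: sequent_def wff_def)

lemma substs_simps [simp]:
  "substs k Cs (Prop p) = Prop p"
  "substs k Cs (NProp p) = NProp p"
  "substs k Cs One = One"
  "substs k Cs Bot = Bot"
  "substs k Cs Zero = Zero"
  "substs k Cs Top = Top"
  "substs k Cs (Tensor A B) = Tensor (substs k Cs A) (substs k Cs B)"
  "substs k Cs (Par A B) = Par (substs k Cs A) (substs k Cs B)"
  "substs k Cs (Plus A B) = Plus (substs k Cs A) (substs k Cs B)"
  "substs k Cs (With A B) = With (substs k Cs A) (substs k Cs B)"
  by (induction Cs arbitrary: A B) auto

lemma substs_fixpoint:
  assumes "\<forall>C \<in> set Cs. closed_below 0 C"
  shows "substs k Cs (Mu \<beta> A) = Mu \<beta> (substs (Suc k) Cs A)"
    and "substs k Cs (Nu \<beta> A) = Nu \<beta> (substs (Suc k) Cs A)"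
  using assms by (induction Cs arbitrary: A) (auto simp: lift_closed)

lemma substs_closed: "closed_below 0 C \<Longrightarrow> substs k Cs C = C"
  by (induction Cs) (auto simp: subst_closed)

lemma substs_Var:
  "\<forall>C \<in> set Cs. closed_below 0 C \<Longrightarrow> n < length Cs \<Longrightarrow> substs 0 Cs (Var n) = Cs ! n"
proof (induction Cs arbitrary: n)
  case (Cons C Cs)
  then show ?case by (cases n) (auto simp: substs_closed)
qed simp

lemma substs_subst:
  assumes "\<forall>C \<in> set Cs. closed_below 0 C" "closed_below 0 D"
  shows "subst (substs (Suc 0) Cs A) 0 D = substs 0 (D # Cs) A"
  using assms by (induction Cs arbitrary: A) (auto simp: subst_subst)

lemma closed_below_substs:
  "\<forall>C \<in> set Cs. closed_below 0 C \<Longrightarrow> closed_below (k + length Cs) A \<Longrightarrow>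
    closed_below k (substs k Cs A)"
  by (induction Cs arbitrary: A) (auto simp: closed_below_subst)

text \<open>
  The unfoldings of a fixed point can be larger than the fixed point itself, so neither the size of
  the formula nor the ordinal decreases by itself. As in a reducibility argument, the structural
  induction proves \<open>P\<close> for every instance of an open formula by closed formulas that satisfy \<open>P\<close>.
  An unfolding of \<open>Mu \<beta> A\<close> is then an instance of \<open>A\<close> with \<open>Mu \<gamma> A\<close> in the place of
  the bound variable, and \<open>Mu \<gamma> A\<close> satisfies \<open>P\<close> by an inner induction on the ordinal.
\<close>

lemma wff_induct [consumes 1,
    case_names Prop NProp One Bot Zero Top Tensor Par Plus With Mu Nu]:
  fixes \<alpha> :: "'o::wellorder" and A :: "('p, 'o) formula"
  assumes "wff \<alpha> A"
    and atoms: "\<And>p. P (Prop p)" "\<And>p. P (NProp p)" "P One" "P Bot" "P Zero" "P Top"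
    and binary: "\<And>A B. P A \<Longrightarrow> P B \<Longrightarrow> P (Tensor A B)" "\<And>A B. P A \<Longrightarrow> P B \<Longrightarrow> P (Par A B)"
      "\<And>A B. P A \<Longrightarrow> P B \<Longrightarrow> P (Plus A B)" "\<And>A B. P A \<Longrightarrow> P B \<Longrightarrow> P (With A B)"
    and mu: "\<And>\<beta> A. \<beta> \<le> \<alpha> \<Longrightarrow> (\<And>\<gamma>. \<gamma> < \<beta> \<Longrightarrow> P (subst A 0 (Mu \<gamma> A))) \<Longrightarrow> P (Mu \<beta> A)"
    and nu: "\<And>\<beta> A. \<beta> \<le> \<alpha> \<Longrightarrow> (\<And>\<gamma>. \<gamma> < \<beta> \<Longrightarrow> P (subst A 0 (Nu \<gamma> A))) \<Longrightarrow> P (Nu \<beta> A)"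
  shows "P A"
proof -
  have "P (substs 0 Cs A)"
    if "closed_below (length Cs) A" "\<forall>\<beta> \<in> ordinals A. \<beta> \<le> \<alpha>"
      "\<forall>C \<in> set Cs. closed_below 0 C \<and> P C" for Cs
    using that
  proof (induction A arbitrary: Cs)
    case (Var n)
    then show ?case by (auto simp: substs_Var)
  next
    case (Mu \<beta> A)
    define B where "B = substs (Suc 0) Cs A"
    have closed: "\<forall>C \<in> set Cs. closed_below 0 C"
      using Mu.prems by blast
    have closed_B: "closed_below (Suc 0) B"
      using Mu.prems closed_below_substs[OF closed, of "Suc 0" A] by (simp add: B_def)
    have "\<beta> \<le> \<alpha> \<Longrightarrow> P (Mu \<beta> B)" for \<beta>
    proof (induction \<beta> rule: less_induct)
      case (less \<beta>)
      have "P (subst B 0 (Mu \<gamma> B))" if "\<gamma> < \<beta>" for \<gamma>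
        using Mu.IH[of "Mu \<gamma> B # Cs"] Mu.prems less that closed_B
        by (auto simp: B_def substs_subst[OF closed] simp del: substs.simps)
      with mu less.prems show ?case by blast
    qed
    then show ?case using Mu.prems by (simp add: substs_fixpoint[OF closed] B_def)
  next
    case (Nu \<beta> A)
    define B where "B = substs (Suc 0) Cs A"
    have closed: "\<forall>C \<in> set Cs. closed_below 0 C"
      using Nu.prems by blast
    have closed_B: "closed_below (Suc 0) B"
      using Nu.prems closed_below_substs[OF closed, of "Suc 0" A] by (simp add: B_def)
    have "\<beta> \<le> \<alpha> \<Longrightarrow> P (Nu \<beta> B)" for \<beta>
    proof (induction \<beta> rule: less_induct)
      case (less \<beta>)
      have "P (subst B 0 (Nu \<gamma> B))" if "\<gamma> < \<beta>" for \<gamma>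
        using Nu.IH[of "Nu \<gamma> B # Cs"] Nu.prems less that closed_B
        by (auto simp: B_def substs_subst[OF closed] simp del: substs.simps)
      with nu less.prems show ?case by blast
    qed
    then show ?case using Nu.prems by (simp add: substs_fixpoint[OF closed] B_def)
  qed (simp_all add: atoms binary)
  from this[of "[]"] show ?thesis using assms(1) by (simp add: wff_def)
qed

section \<open>Soundness\<close>

fun unfocused :: "('p, 'o) focussed_sequent \<Rightarrow> ('p, 'o) formula multiset" where
  "unfocused (\<Gamma> \<Down> A) = \<Gamma> + {#A#}"
| "unfocused (\<Gamma> \<Up> \<Theta>) = \<Gamma> + mset \<Theta>"

lemma provable_foc_sound: "provable_foc \<alpha> S \<Longrightarrow> provable_cf \<alpha> (unfocused S)"
proof (induction rule: provable_foc.induct)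
  case (foc_id A)
  then show ?case using cf_id[of \<alpha> A] by (simp add: add_mset_commute)
next
  case (foc_top \<Gamma> \<Delta>)
  then show ?case using cf_top[of \<alpha> "\<Gamma> + mset \<Delta>"] by simp
next
  case (foc_bot \<Gamma> \<Delta>)
  then show ?case using cf_bot[of \<alpha> "\<Gamma> + mset \<Delta>"] by simp
next
  case (foc_par \<Gamma> \<Delta> A B)
  then show ?case using cf_par[of \<alpha> "\<Gamma> + mset \<Delta>" A B] by simp
next
  case (foc_with \<Gamma> \<Delta> A B)
  then show ?case using cf_with[of \<alpha> "\<Gamma> + mset \<Delta>" A B] by simp
next
  case (foc_nu \<beta> \<Gamma> \<Delta> A)
  then show ?case using cf_nu[of \<beta> \<alpha> "\<Gamma> + mset \<Delta>" A] by simp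
next
  case foc_one
  then show ?case using cf_one[of \<alpha>] by simp
next
  case (foc_plus0 \<Gamma> A B)
  then show ?case using cf_plus0[of \<alpha> \<Gamma> A B] by simp
next
  case (foc_plus1 \<Gamma> B A)
  then show ?case using cf_plus1[of \<alpha> \<Gamma> B A] by simp
next
  case (foc_tensor \<Gamma> A \<Delta> B)
  then show ?case using cf_tensor[of \<alpha> \<Gamma> A \<Delta> B] by simp
next
  case (foc_mu \<beta> \<gamma> \<Gamma> A)
  then show ?case using cf_mu[of \<beta> \<alpha> \<gamma> \<Gamma> A] by simp
qed simp_all

section \<open>Outcomes of asynchronous phases\<close>

abbreviation storable :: "('p, 'o) formula \<Rightarrow> bool" where
  "storable A \<equiv> positive A \<or> literal A"

text \<open>
  An outcome of \<open>A\<close> is what an open branch of an asynchronous phase started on \<open>A\<close> adds to the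
  stored formulas.
\<close>

inductive outcome :: "('p, 'o::wellorder) formula \<Rightarrow> ('p, 'o) formula multiset \<Rightarrow> bool" where
  outcome_store: "storable A \<Longrightarrow> outcome A {#A#}"
| outcome_bot: "outcome Bot {#}"
| outcome_par: "outcome A M \<Longrightarrow> outcome B N \<Longrightarrow> outcome (Par A B) (M + N)"
| outcome_with0: "outcome A M \<Longrightarrow> outcome (With A B) M"
| outcome_with1: "outcome B M \<Longrightarrow> outcome (With A B) M"
| outcome_nu: "\<gamma> < \<beta> \<Longrightarrow> outcome (subst A 0 (Nu \<gamma> A)) M \<Longrightarrow> outcome (Nu \<beta> A) M"

lemma outcome_storable: "storable A \<Longrightarrow> outcome A M \<longleftrightarrow> M = {#A#}"
  by (auto elim: outcome.cases intro: outcome_store)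

lemma outcome_simps [simp]:
  "outcome (Prop p) M \<longleftrightarrow> M = {#Prop p#}"
  "outcome (NProp p) M \<longleftrightarrow> M = {#NProp p#}"
  "outcome One M \<longleftrightarrow> M = {#One#}"
  "outcome Bot M \<longleftrightarrow> M = {#}"
  "outcome Zero M \<longleftrightarrow> M = {#Zero#}"
  "outcome Top M \<longleftrightarrow> False"
  "outcome (Tensor A B) M \<longleftrightarrow> M = {#Tensor A B#}"
  "outcome (Par A B) M \<longleftrightarrow> (\<exists>M1 M2. M = M1 + M2 \<and> outcome A M1 \<and> outcome B M2)"
  "outcome (Plus A B) M \<longleftrightarrow> M = {#Plus A B#}"
  "outcome (With A B) M \<longleftrightarrow> outcome A M \<or> outcome B M"
  "outcome (Mu \<beta> A) M \<longleftrightarrow> M = {#Mu \<beta> A#}"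
  "outcome (Nu \<beta> A) M \<longleftrightarrow> (\<exists>\<gamma> < \<beta>. outcome (subst A 0 (Nu \<gamma> A)) M)"
  by (simp_all add: outcome_storable) (subst outcome.simps, simp; blast)+

inductive outcomes ::
  "('p, 'o::wellorder) formula multiset \<Rightarrow> ('p, 'o) formula multiset \<Rightarrow> bool" where
  outcomes_empty: "outcomes {#} {#}"
| outcomes_add: "outcomes \<Gamma> M \<Longrightarrow> outcome A N \<Longrightarrow> outcomes (add_mset A \<Gamma>) (M + N)"

lemma outcomes_empty_iff [simp]: "outcomes {#} M \<longleftrightarrow> M = {#}"
  by (auto elim: outcomes.cases intro: outcomes_empty)

text \<open>
  The formulas of a multiset may have been added in any order; this inversion holds for each of
  them, not only for the last one added.
\<close>

lemma outcomes_add_iff [simp]: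
  "outcomes (add_mset A \<Gamma>) M \<longleftrightarrow> (\<exists>M1 N. M = M1 + N \<and> outcomes \<Gamma> M1 \<and> outcome A N)"
proof
  have "\<exists>M1 N. M = M1 + N \<and> outcomes \<Gamma> M1 \<and> outcome A N"
    if "outcomes \<Delta> M" "\<Delta> = add_mset A \<Gamma>" for \<Delta>
    using that
  proof (induction arbitrary: \<Gamma>)
    case (outcomes_add \<Delta> M B N)
    show ?case
    proof (cases "A = B")
      case True
      then show ?thesis using outcomes_add by auto
    next
      case False
      then obtain \<Gamma>' where \<Gamma>': "\<Delta> = add_mset A \<Gamma>'" "\<Gamma> = add_mset B \<Gamma>'"
        using outcomes_add.prems by (auto simp: add_eq_conv_ex)
      then obtain M1 N1 where "M = M1 + N1" "outcomes \<Gamma>' M1" "outcome A N1"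
        using outcomes_add.IH by blast
      then have "M + N = (M1 + N) + N1" "outcomes \<Gamma> (M1 + N)" "outcome A N1"
        using outcomes_add.hyps \<Gamma>' by (auto intro: outcomes.outcomes_add simp: ac_simps)
      then show ?thesis by blast
    qed
  qed simp
  then show "outcomes (add_mset A \<Gamma>) M \<Longrightarrow>
    \<exists>M1 N. M = M1 + N \<and> outcomes \<Gamma> M1 \<and> outcome A N" by blast
qed (auto intro: outcomes_add)

lemma outcomes_union:
  "outcomes (\<Gamma> + \<Delta>) M \<longleftrightarrow> (\<exists>M1 M2. M = M1 + M2 \<and> outcomes \<Gamma> M1 \<and> outcomes \<Delta> M2)"
proof (induction \<Delta> arbitrary: M)
  case (add A \<Delta>)
  show ?case by (simp add: add.IH) (metis add.assoc)
qed simp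

text \<open>
  It is here that termination of asynchronous phases matters: a formula without outcomes, such as
  \<open>Par Top A\<close>, must still be decomposed completely before \<open>Top\<close> is reached, because the focussed
  rules only act on the end of the list. The claim for arbitrary \<open>\<Theta>\<close> lets the case of par apply the
  induction hypotheses to its components one after the other.
\<close>

lemma provable_foc_async:
  assumes "wff \<alpha> A" "\<And>N. outcome A N \<Longrightarrow> provable_foc \<alpha> (\<Gamma> + N \<Up> \<Theta>)"
  shows "provable_foc \<alpha> (\<Gamma> \<Up> \<Theta> @ [A])"
  using assms
proof (induction A arbitrary: \<Gamma> \<Theta> rule: wff_induct)
  case (Par A B)
  have "provable_foc \<alpha> (\<Gamma> \<Up> (\<Theta> @ [A]) @ [B])"
  proof (intro Par.IH)
    fix M N assume "outcome A M" "outcome B N"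
    then show "provable_foc \<alpha> (\<Gamma> + N + M \<Up> \<Theta>)"
      using Par.prems[of "M + N"] by (auto simp: ac_simps)
  qed
  then show ?case by (auto intro: foc_par)
next
  case (With A B)
  then show ?case by (auto intro!: foc_with)
next
  case (Nu \<beta> A)
  have "provable_foc \<alpha> (\<Gamma> \<Up> \<Theta> @ [subst A 0 (Nu \<gamma> A)])" if "\<gamma> < \<beta>" for \<gamma>
    using that by (intro Nu.IH Nu.prems) auto
  with Nu.hyps show ?case by (rule foc_nu)
qed (auto intro: foc_store foc_top foc_bot)

definition foc_outcomes :: "'o::wellorder \<Rightarrow> ('p, 'o) formula multiset \<Rightarrow> bool" where
  "foc_outcomes \<alpha> \<Gamma> \<longleftrightarrow> (\<forall>M. outcomes \<Gamma> M \<longrightarrow> provable_foc \<alpha> (M \<Up> []))"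

lemma provable_foc_of_outcomes:
  assumes "\<forall>A \<in> set \<Theta>. wff \<alpha> A" "foc_outcomes \<alpha> (mset \<Theta>)"
  shows "provable_foc \<alpha> ({#} \<Up> \<Theta>)"
proof -
  \<comment> \<open>Formulas at the end of the list leave their outcomes in the store, hence an arbitrary \<open>\<Gamma>\<close>.\<close>
  have "provable_foc \<alpha> (\<Gamma> \<Up> \<Theta>)"
    if "\<And>M. outcomes (mset \<Theta>) M \<Longrightarrow> provable_foc \<alpha> (\<Gamma> + M \<Up> [])" for \<Gamma>
    using assms(1) that
  proof (induction \<Theta> arbitrary: \<Gamma> rule: rev_induct)
    case (snoc A \<Theta>)
    show ?case
    proof (rule provable_foc_async)
      fix N assume "outcome A N"
      then show "provable_foc \<alpha> (\<Gamma> + N \<Up> \<Theta>)"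
        using snoc.prems by (intro snoc.IH) (auto simp: add.assoc add.commute[of N])
    qed (use snoc.prems in simp)
  qed (use that in simp)
  then show ?thesis using assms(2) by (simp add: foc_outcomes_def)
qed

section \<open>Synchronous rules outside a focus\<close>

text \<open>
  A stored formula \<open>A\<close> is inert until it is decided upon or meets its negation in an axiom. So
  \<open>\<Sigma>\<close> can stand in for it throughout a proof, as long as it can do so where \<open>A\<close> is used. In the
  induction, a decision for \<open>A\<close> is exactly the situation covered by the hypothesis, and all rules that
  do not touch \<open>A\<close> carry over.
\<close>

lemma foc_replace:
  assumes A: "storable A"
    and focus: "\<And>\<Gamma>. provable_foc \<alpha> (\<Gamma> \<Down> A) \<Longrightarrow> provable_foc \<alpha> (\<Gamma> + \<Sigma> \<Up> [])"
  shows "provable_foc \<alpha> S \<Longrightarrow>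
    (\<forall>\<Gamma> C. S = (add_mset A \<Gamma> \<Down> C) \<longrightarrow> provable_foc \<alpha> (\<Gamma> + \<Sigma> \<Down> C)) \<and>
    (\<forall>\<Gamma> \<Theta>. S = (add_mset A \<Gamma> \<Up> \<Theta>) \<longrightarrow> provable_foc \<alpha> (\<Gamma> + \<Sigma> \<Up> \<Theta>))"
proof (induction rule: provable_foc.induct)
  case (foc_id B)
  \<comment> \<open>The literal \<open>neg A\<close> in focus is released and stored, so that the axiom with the roles of
    \<open>A\<close> and \<open>neg A\<close> exchanged can serve as the proof that has \<open>A\<close> in focus.\<close>
  have "provable_foc \<alpha> (\<Sigma> \<Down> neg B)" if "B = A"
  proof -
    have lit: "literal (neg A)"
      using foc_id that by (cases A) auto
    have "provable_foc \<alpha> ({#neg A#} \<Down> A)"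
      using provable_foc.foc_id[OF lit] by simp
    then have "provable_foc \<alpha> (\<Sigma> + {#neg A#} \<Up> [])"
      using focus by (metis add.commute)
    then have "provable_foc \<alpha> (\<Sigma> \<Up> [] @ [neg A])"
      using lit by (intro foc_store) auto
    then show ?thesis using lit that by (auto intro: foc_release)
  qed
  then show ?case by auto
next
  case (foc_store C \<Gamma> \<Theta>)
  have "provable_foc \<alpha> (\<Gamma>' + \<Sigma> \<Up> \<Theta> @ [C])" if "\<Gamma> = add_mset A \<Gamma>'" for \<Gamma>'
    using foc_store.IH foc_store.hyps that by (intro provable_foc.foc_store) auto
  then show ?case by simp
next
  case (foc_decide C \<Gamma>)
  have "provable_foc \<alpha> (\<Gamma>' + \<Sigma> \<Up> [])" if eq: "add_mset C \<Gamma> = add_mset A \<Gamma>'" for \<Gamma>'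
  proof (cases "C = A")
    case True
    then show ?thesis using eq focus foc_decide.hyps by simp
  next
    case False
    then obtain \<Delta> where "\<Gamma> = add_mset A \<Delta>" "\<Gamma>' = add_mset C \<Delta>"
      using eq by (auto simp: add_eq_conv_ex)
    then show ?thesis
      using foc_decide provable_foc.foc_decide[of C \<alpha> "\<Delta> + \<Sigma>"] by auto
  qed
  then show ?case by simp
next
  case (foc_tensor \<Gamma> C \<Delta> D)
  have "provable_foc \<alpha> (\<Pi> + \<Sigma> \<Down> Tensor C D)" if eq: "\<Gamma> + \<Delta> = add_mset A \<Pi>" for \<Pi>
  proof -
    have "A \<in># \<Gamma> + \<Delta>" using eq by simp
    then consider (left) \<Gamma>' where "\<Gamma> = add_mset A \<Gamma>'" | (right) \<Delta>' where "\<Delta> = add_mset A \<Delta>'"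
      by (metis mset_add union_iff)
    then show ?thesis
    proof cases
      case left
      then have "provable_foc \<alpha> (\<Gamma>' + \<Sigma> + \<Delta> \<Down> Tensor C D)"
        using foc_tensor by (intro provable_foc.foc_tensor) auto
      then show ?thesis using left eq by (auto simp: ac_simps)
    next
      case right
      then have "provable_foc \<alpha> (\<Gamma> + (\<Delta>' + \<Sigma>) \<Down> Tensor C D)"
        using foc_tensor by (intro provable_foc.foc_tensor) auto
      then show ?thesis using right eq by (auto simp: ac_simps)
    qed
  qed
  then show ?case by simp
qed (auto intro: provable_foc.intros)

lemma storable_or_negative: "wff \<alpha> A \<Longrightarrow> storable A \<or> negative A"
  by (cases A) (auto simp: wff_def)

text \<open>
  This extends the replacement to formulas of either polarity. A negative formula need not be
  traced through the proof: it can be put under focus at the root and released at once.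
\<close>

lemma foc_focus_on:
  assumes A: "wff \<alpha> A"
    and outcomes: "\<And>N. outcome A N \<Longrightarrow> provable_foc \<alpha> (\<Gamma> + N \<Up> [])"
    and focus: "\<And>\<Gamma>. provable_foc \<alpha> (\<Gamma> \<Down> A) \<Longrightarrow> provable_foc \<alpha> (\<Gamma> + \<Sigma> \<Up> [])"
  shows "provable_foc \<alpha> (\<Gamma> + \<Sigma> \<Up> [])"
proof (cases "storable A")
  case True
  then have "provable_foc \<alpha> (add_mset A \<Gamma> \<Up> [])"
    using outcomes[of "{#A#}"] by (simp add: outcome_storable)
  then show ?thesis using foc_replace[OF True focus] by blast
next
  case False
  then have "negative A" using A storable_or_negative by blast
  moreover have "provable_foc \<alpha> (\<Gamma> \<Up> [A])"
    using provable_foc_async[OF A, of \<Gamma> "[]"] outcomes by simp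
  ultimately show ?thesis by (intro focus foc_release) auto
qed

section \<open>Completeness: goodness is closed under the unfocussed rules\<close>

lemma foc_outcomes_add:
  "foc_outcomes \<alpha> (add_mset A \<Gamma>) \<longleftrightarrow>
    (\<forall>M N. outcomes \<Gamma> M \<longrightarrow> outcome A N \<longrightarrow> provable_foc \<alpha> (M + N \<Up> []))"
  unfolding foc_outcomes_def outcomes_add_iff by blast

lemma foc_outcomes_one: "foc_outcomes \<alpha> {#One#}"
  using foc_decide[OF _ foc_one] by (auto simp: foc_outcomes_def)

lemma foc_outcomes_bot: "foc_outcomes \<alpha> \<Gamma> \<Longrightarrow> foc_outcomes \<alpha> (add_mset Bot \<Gamma>)"
  by (auto simp: foc_outcomes_def)

lemma foc_outcomes_top: "foc_outcomes \<alpha> (add_mset Top \<Gamma>)"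
  by (auto simp: foc_outcomes_def)

lemma foc_outcomes_par:
  "foc_outcomes \<alpha> (add_mset A (add_mset B \<Gamma>)) \<Longrightarrow> foc_outcomes \<alpha> (add_mset (Par A B) \<Gamma>)"
  unfolding foc_outcomes_def by (force simp: ac_simps)

lemma foc_outcomes_with:
  "foc_outcomes \<alpha> (add_mset A \<Gamma>) \<Longrightarrow> foc_outcomes \<alpha> (add_mset B \<Gamma>) \<Longrightarrow>
    foc_outcomes \<alpha> (add_mset (With A B) \<Gamma>)"
  by (auto simp: foc_outcomes_add)

lemma foc_outcomes_nu:
  "(\<And>\<gamma>. \<gamma> < \<beta> \<Longrightarrow> foc_outcomes \<alpha> (add_mset (subst A 0 (Nu \<gamma> A)) \<Gamma>)) \<Longrightarrow>
    foc_outcomes \<alpha> (add_mset (Nu \<beta> A) \<Gamma>)"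
  unfolding foc_outcomes_add by auto

text \<open>The common part of the rules for plus and \<open>Mu\<close>, where the principal formula stands in for
  its component.\<close>

lemma foc_outcomes_sync:
  assumes "wff \<alpha> A" "positive B" "foc_outcomes \<alpha> (add_mset A \<Gamma>)"
    and rule: "\<And>\<Gamma>. provable_foc \<alpha> (\<Gamma> \<Down> A) \<Longrightarrow> provable_foc \<alpha> (\<Gamma> \<Down> B)"
  shows "foc_outcomes \<alpha> (add_mset B \<Gamma>)"
  unfolding foc_outcomes_add
proof (intro allI impI)
  fix M N assume M: "outcomes \<Gamma> M" and N: "outcome B N"
  have "provable_foc \<alpha> (M + {#B#} \<Up> [])"
    using assms(1)
  proof (rule foc_focus_on)
    fix N assume "outcome A N"
    then show "provable_foc \<alpha> (M + N \<Up> [])"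
      using M assms(3) by (simp add: foc_outcomes_add)
  next
    fix \<Delta> assume "provable_foc \<alpha> (\<Delta> \<Down> A)"
    then show "provable_foc \<alpha> (\<Delta> + {#B#} \<Up> [])"
      using rule assms(2) by (intro foc_decide)
  qed
  then show "provable_foc \<alpha> (M + N \<Up> [])"
    using N assms(2) by (simp add: outcome_storable)
qed

text \<open>
  Two nested replacements: in the proof for \<open>B\<close>, the formula \<open>B\<close> is replaced by the left
  context together with the tensor; wherever \<open>B\<close> comes under focus, the whole proof for \<open>A\<close> is
  inserted, and in it \<open>A\<close> is replaced by the tensor and the context present at that point. Only
  when both are under focus is the tensor rule applied.
\<close>

lemma foc_outcomes_tensor:
  assumes "wff \<alpha> A" "wff \<alpha> B"
    and A: "foc_outcomes \<alpha> (add_mset A \<Gamma>)" and B: "foc_outcomes \<alpha> (add_mset B \<Delta>)"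
  shows "foc_outcomes \<alpha> (add_mset (Tensor A B) (\<Gamma> + \<Delta>))"
proof -
  have "provable_foc \<alpha> (M2 + (M1 + {#Tensor A B#}) \<Up> [])"
    if M1: "outcomes \<Gamma> M1" and M2: "outcomes \<Delta> M2" for M1 M2
    using assms(2)
  proof (rule foc_focus_on)
    fix N assume "outcome B N"
    then show "provable_foc \<alpha> (M2 + N \<Up> [])"
      using M2 B by (simp add: foc_outcomes_add)
  next
    fix \<Delta>' assume \<Delta>': "provable_foc \<alpha> (\<Delta>' \<Down> B)"
    have "provable_foc \<alpha> (M1 + (\<Delta>' + {#Tensor A B#}) \<Up> [])"
      using assms(1)
    proof (rule foc_focus_on)
      fix N assume "outcome A N"
      then show "provable_foc \<alpha> (M1 + N \<Up> [])"
        using M1 A by (simp add: foc_outcomes_add)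
    next
      fix \<Gamma>' assume "provable_foc \<alpha> (\<Gamma>' \<Down> A)"
      then have "provable_foc \<alpha> (\<Gamma>' + \<Delta>' + {#Tensor A B#} \<Up> [])"
        using \<Delta>' by (intro foc_decide foc_tensor) auto
      then show "provable_foc \<alpha> (\<Gamma>' + (\<Delta>' + {#Tensor A B#}) \<Up> [])"
        by (simp add: ac_simps)
    qed
    then show "provable_foc \<alpha> (\<Delta>' + (M1 + {#Tensor A B#}) \<Up> [])"
      by (simp add: ac_simps)
  qed
  then have "provable_foc \<alpha> (add_mset (Tensor A B) (M1 + M2) \<Up> [])"
    if "outcomes \<Gamma> M1" "outcomes \<Delta> M2" for M1 M2
    using that by (simp add: add.commute[of M1])
  then show ?thesis by (auto simp: foc_outcomes_add outcomes_union)
qed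

lemma foc_outcomes_plus:
  assumes "wff \<alpha> A"
  shows "foc_outcomes \<alpha> (add_mset A \<Gamma>) \<Longrightarrow> foc_outcomes \<alpha> (add_mset (Plus A B) \<Gamma>)"
    and "foc_outcomes \<alpha> (add_mset A \<Gamma>) \<Longrightarrow> foc_outcomes \<alpha> (add_mset (Plus B A) \<Gamma>)"
  using assms by (auto intro: foc_outcomes_sync foc_plus0 foc_plus1)

lemma foc_outcomes_mu:
  assumes "wff \<alpha> (Mu \<beta> A)" "\<gamma> < \<beta>" "foc_outcomes \<alpha> (add_mset (subst A 0 (Mu \<gamma> A)) \<Gamma>)"
  shows "foc_outcomes \<alpha> (add_mset (Mu \<beta> A) \<Gamma>)"
  using wff_unfold(1)[OF assms(2,1)]
proof (rule foc_outcomes_sync)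
  have "\<beta> \<le> \<alpha>" using assms(1) by (simp add: wff_def)
  then show "provable_foc \<alpha> (\<Gamma> \<Down> Mu \<beta> A)"
    if "provable_foc \<alpha> (\<Gamma> \<Down> subst A 0 (Mu \<gamma> A))" for \<Gamma>
    using assms(2) that by (rule foc_mu)
qed (use assms in auto)


lemma wff_neg: "wff \<alpha> A \<Longrightarrow> wff \<alpha> (neg A)"
proof -
  have "closed_below k (neg A) \<longleftrightarrow> closed_below k A" for k
    by (induction A arbitrary: k) auto
  moreover have "ordinals (neg A) = ordinals A"
    by (induction A) auto
  ultimately show "wff \<alpha> A \<Longrightarrow> wff \<alpha> (neg A)" by (simp add: wff_def)
qed

text \<open>
  The decision must fall on \<open>Prop p\<close>, so the axiom is the one with the negative literal in the store.
\<close>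

lemma foc_outcomes_literals: "foc_outcomes \<alpha> {#Prop p, NProp p#}"
proof -
  have "provable_foc \<alpha> ({#NProp p#} \<Down> Prop p)"
    using foc_id[of "NProp p" \<alpha>] by simp
  then have "provable_foc \<alpha> ({#NProp p#} + {#Prop p#} \<Up> [])"
    by (intro foc_decide) auto
  then show ?thesis by (simp add: foc_outcomes_def add_mset_commute)
qed

text \<open>
  The steps of identity expansion are stated for positive connectives. Their duals follow by
  exchanging a formula with its negation.
\<close>

lemma foc_outcomes_id_tensor:
  assumes "wff \<alpha> (Tensor A B)" "foc_outcomes \<alpha> {#A, neg A#}" "foc_outcomes \<alpha> {#B, neg B#}"
  shows "foc_outcomes \<alpha> {#Tensor A B, neg (Tensor A B)#}"
proof -
  have "foc_outcomes \<alpha> (add_mset (Tensor A B) ({#neg A#} + {#neg B#}))"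
    using assms by (intro foc_outcomes_tensor) auto
  then have "foc_outcomes \<alpha> {#neg A, neg B, Tensor A B#}"
    by (simp add: add_mset_commute)
  then show ?thesis using foc_outcomes_par by (fastforce simp: add_mset_commute)
qed

lemma foc_outcomes_id_plus:
  assumes "wff \<alpha> (Plus A B)" "foc_outcomes \<alpha> {#A, neg A#}" "foc_outcomes \<alpha> {#B, neg B#}"
  shows "foc_outcomes \<alpha> {#Plus A B, neg (Plus A B)#}"
proof -
  have "foc_outcomes \<alpha> {#Plus A B, neg A#}" "foc_outcomes \<alpha> {#Plus A B, neg B#}"
    using assms by (auto intro: foc_outcomes_plus)
  then show ?thesis
    using foc_outcomes_with[of \<alpha> "neg A" "{#Plus A B#}" "neg B"] by (simp add: add_mset_commute)
qed

lemma foc_outcomes_id_mu: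
  assumes "wff \<alpha> (Mu \<beta> A)"
    and "\<And>\<gamma>. \<gamma> < \<beta> \<Longrightarrow>
      foc_outcomes \<alpha> {#subst A 0 (Mu \<gamma> A), neg (subst A 0 (Mu \<gamma> A))#}"
  shows "foc_outcomes \<alpha> {#Mu \<beta> A, neg (Mu \<beta> A)#}"
proof -
  have "foc_outcomes \<alpha> {#subst (neg A) 0 (Nu \<gamma> (neg A)), Mu \<beta> A#}" if "\<gamma> < \<beta>" for \<gamma>
    using foc_outcomes_mu[OF assms(1) that assms(2)[OF that]]
    by (simp add: neg_subst add_mset_commute)
  then show ?thesis
    using foc_outcomes_nu[of \<beta> \<alpha> "neg A" "{#Mu \<beta> A#}"] by (simp add: add_mset_commute)
qed

text \<open>
  Well-formedness is assumed twice in the proof, once for the induction and once as a premise that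
  each step carries along, since the synchronous rules require it of their active formulas.
\<close>

lemma foc_outcomes_id:
  assumes "wff \<alpha> A"
  shows "foc_outcomes \<alpha> {#A, neg A#}"
  using assms assms
proof (induction A rule: wff_induct)
  case (Prop p)
  show ?case using foc_outcomes_literals[of \<alpha> p] by simp
next
  case (NProp p)
  show ?case using foc_outcomes_literals[of \<alpha> p] by (simp add: add_mset_commute)
next
  case One
  show ?case using foc_outcomes_bot[OF foc_outcomes_one, of \<alpha>] by (simp add: add_mset_commute)
next
  case Bot
  show ?case using foc_outcomes_bot[OF foc_outcomes_one, of \<alpha>] by simp
next
  case Zero
  show ?case using foc_outcomes_top[of \<alpha> "{#Zero#}"] by (simp add: add_mset_commute)
next
  case Top
  show ?case using foc_outcomes_top[of \<alpha> "{#Zero#}"] by simp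
next
  case (Tensor A B)
  then show ?case by (intro foc_outcomes_id_tensor) auto
next
  case (Par A B)
  then have "foc_outcomes \<alpha> {#Tensor (neg A) (neg B), neg (Tensor (neg A) (neg B))#}"
    by (intro foc_outcomes_id_tensor) (auto simp: add_mset_commute wff_neg)
  then show ?case by (simp add: add_mset_commute)
next
  case (Plus A B)
  then show ?case by (intro foc_outcomes_id_plus) auto
next
  case (With A B)
  then have "foc_outcomes \<alpha> {#Plus (neg A) (neg B), neg (Plus (neg A) (neg B))#}"
    by (intro foc_outcomes_id_plus) (auto simp: add_mset_commute wff_neg)
  then show ?case by (simp add: add_mset_commute)
next
  case (Mu \<beta> A)
  then show ?case by (intro foc_outcomes_id_mu) (auto intro: wff_unfold)
next
  case (Nu \<beta> A)
  have "foc_outcomes \<alpha> {#Mu \<beta> (neg A), neg (Mu \<beta> (neg A))#}"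
  proof (rule foc_outcomes_id_mu)
    show "wff \<alpha> (Mu \<beta> (neg A))" using wff_neg[OF Nu.prems] by simp
    fix \<gamma> assume "\<gamma> < \<beta>"
    then have "foc_outcomes \<alpha> {#subst A 0 (Nu \<gamma> A), neg (subst A 0 (Nu \<gamma> A))#}"
      using Nu by (auto intro: wff_unfold)
    then show "foc_outcomes \<alpha>
      {#subst (neg A) 0 (Mu \<gamma> (neg A)), neg (subst (neg A) 0 (Mu \<gamma> (neg A)))#}"
      by (simp add: neg_subst add_mset_commute)
  qed
  then show ?case by (simp add: add_mset_commute)
qed

lemma provable_cf_foc_outcomes:
  "provable_cf \<alpha> \<Gamma> \<Longrightarrow> sequent \<alpha> \<Gamma> \<Longrightarrow> foc_outcomes \<alpha> \<Gamma>"
proof (induction rule: provable_cf.induct)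
  case (cf_mu \<beta> \<gamma> \<Gamma> A)
  then show ?case using foc_outcomes_mu[of \<alpha> \<beta> A \<gamma> \<Gamma>]
    by (auto simp: sequent_wff wff_unfold)
next
  case (cf_nu \<beta> \<Gamma> A)
  then show ?case using foc_outcomes_nu[of \<beta> \<alpha> A \<Gamma>]
    by (auto simp: sequent_wff wff_unfold)
qed (auto simp: sequent_wff foc_outcomes_id foc_outcomes_one foc_outcomes_top
  intro: foc_outcomes_bot foc_outcomes_tensor foc_outcomes_par foc_outcomes_plus foc_outcomes_with)

theorem theorem3p11:
  fixes \<alpha> :: "'o::wellorder"
    and \<Gamma> :: "('p, 'o) formula multiset"
    and \<Theta> :: "('p, 'o) formula list"
  assumes "sequent \<alpha> \<Gamma>"
    and "mset \<Theta> = \<Gamma>"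
  shows "provable_cf \<alpha> \<Gamma> \<longleftrightarrow> provable_foc \<alpha> ({#} \<Up> \<Theta>)"
proof
  assume "provable_cf \<alpha> \<Gamma>"
  then have "foc_outcomes \<alpha> (mset \<Theta>)"
    using assms by (simp add: provable_cf_foc_outcomes)
  moreover have "\<forall>A \<in> set \<Theta>. wff \<alpha> A"
    using assms by (auto simp: sequent_wff)
  ultimately show "provable_foc \<alpha> ({#} \<Up> \<Theta>)"
    by (intro provable_foc_of_outcomes)
next
  assume "provable_foc \<alpha> ({#} \<Up> \<Theta>)"
  then show "provable_cf \<alpha> \<Gamma>"
    using provable_foc_sound[of \<alpha> "{#} \<Up> \<Theta>"] assms(2) by simp
qed

end
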